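(* Assume the nonresonance condition: the only function $u^h:N^+\to\mathbb{C}$ with $L^h u^h=0$ on $M^+$ and $u^h|_\gamma=0$ is $u^h=0$. Assume that the capacity matrix $S_{\gamma\gamma}$, the $|\gamma|\times|\gamma|$ matrix with entries $h^2G^h_{\gamma_i-\gamma_j}$ for $\gamma_i,\gamma_j\in\gamma$, is nonsingular. Let $f^{h,\pm}$ be finitely supported source vectors with $\operatorname{supp}f^{h,\pm}\subseteq M^\pm$, let $u^{h,\pm}=G^h\ast f^{h,\pm}$ and $\xi_\gamma=(u^{h,+}+u^{h,-})|_\gamma$. Then the shielding control can be chosen with support in $\gamma^-$: there is an admissible extension $V^h$ of $\xi_\gamma$ such that $g^h=-(L^hV^h)\mathbf 1_{M^-}$ is a shielding control and $$\operatorname{supp}g^h\subseteq\gamma^- .$$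
   Context: Lattice and operator. Let $d\in\{2,3\}$, $h>0$, wavenumber $k>0$. Functions on the lattice $\Lambda_h=h\mathbb{Z}^d$ are indexed by $\mathbb{Z}^d$ (node $h\bm m\leftrightarrow\bm m$). The discrete Helmholtz operator is $$(L^hv)_{\bm m}=-\frac1{h^2}\sum_{\bm e\in\mathbb{Z}^d,\,|\bm e|_1=1}(v_{\bm m+\bm e}-v_{\bm m})-k^2v_{\bm m}.$$ Geometry. $\Omega_{\rm in}\subset\mathbb{R}^d$ is a bounded Lipschitz domain, $M^+=\{\bm m\in\mathbb{Z}^d: h\bm m\in\Omega_{\rm in}\}$, $M^-=\{\bm m\in\mathbb{Z}^d: h\bm m\notin\overline{\Omega_{\rm in}}\}$, and no lattice node lies on $\partial\Omega_{\rm in}$, so $\mathbb{Z}^d=M^+\sqcup M^-$. $N^\pm$ is the set of all nodes of the stencils of $L^h$ centred in $M^\pm$: $N^\pm=M^\pm\cup\{\bm m+\bm e:\bm m\in M^\pm,|\bm e|_1=1\}$. The boundary strip is $\gamma=N^+\cap N^-$, with $\gamma^\pm=\gamma\cap M^\pm$. $\mathbf{1}_A$ is the indicator of $A$. Lattice Green's function. $$G^h_{\bm m}=\frac1{(2\pi)^d}\int_{[-\pi,\pi]^d}\frac{e^{i\bm m\cdot\bm\theta}}{\sigma(\bm\theta)-k^2h^2+i0^+}\,d\bm\theta,\qquad \sigma(\bm\theta)=\sum_{j=1}^d2(1-\cos\theta_j),$$ where $i0^+$ means the limit $\varepsilon\to0^+$ with $i\varepsilon$ in place of $i0^+$; $(h,k)$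 are assumed such that the limit exists. Then $L^hG^h=h^{-2}\delta_{\bm 0}$. For finitely supported $f$, $(G^h\ast f)_{\bm m}=h^2\sum_{\bm n}G^h_{\bm m-\bm n}f_{\bm n}$, so $L^h(G^h\ast f)=f$; $G^h\ast f$ is called the outgoing solution generated by $f$. Admissible extension. $V^h:\mathbb{Z}^d\to\mathbb{C}$ is an admissible extension of $\xi_\gamma:\gamma\to\mathbb{C}$ if $V^h|_\gamma=\xi_\gamma$, $L^hV^h$ has finite support, and either $V^h$ is finitely supported or $V^h=G^h\ast(L^hV^h)$. Shielding control. A finitely supported $g^h$ with $\operatorname{supp}g^h\subseteq M^-$ is a shielding control for the sources $f^{h,\pm}$ if $\widetilde u^h=G^h\ast(f^{h,+}+f^{h,-}+g^h)$ satisfies $\widetilde u^h|_{N^+}=u^{h,+}|_{N^+}$. *)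

theory Defs
  imports "HOL-Analysis.Analysis" "Jordan_Normal_Form.Matrix"
begin

no_notation Matrix.vec_index (infixl \<open>$\<close> 100)
no_notation Matrix.scalar_prod (infix \<open>\<bullet>\<close> 70)
hide_const (open) Matrix.vec

text \<open>The lattice \<open>h \<int>\<^sup>d\<close> is indexed by \<open>int ^ 'n\<close> with \<open>d = CARD('n)\<close>.\<close>

definition unit_steps :: "(int ^ 'n) set" where
  "unit_steps = {e. (\<Sum>j\<in>UNIV. \<bar>e $ j\<bar>) = 1}"

definition node :: "real \<Rightarrow> int ^ 'n \<Rightarrow> real ^ 'n" where
  "node h m = (\<chi> j. h * real_of_int (m $ j))"

definition helmholtz :: "real \<Rightarrow> real \<Rightarrow> (int ^ 'n \<Rightarrow> complex) \<Rightarrow> int ^ 'n \<Rightarrow> complex" where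
  "helmholtz h k v m =
     - (1 / (complex_of_real h)\<^sup>2) * (\<Sum>e\<in>unit_steps. v (m + e) - v m)
     - (complex_of_real k)\<^sup>2 * v m"

text \<open>A domain is Lipschitz if near each boundary point it is the strict epigraph, in some unit
  direction \<open>\<nu>\<close>, of a Lipschitz function on the hyperplane orthogonal to \<open>\<nu>\<close>; choosing \<open>\<nu>\<close> and
  identifying that hyperplane with \<open>\<real>\<^sup>d\<^sup>-\<^sup>1\<close> is the usual rotation of coordinates.\<close>

definition bounded_lipschitz_domain :: "'a::euclidean_space set \<Rightarrow> bool" where
  "bounded_lipschitz_domain \<Omega> \<longleftrightarrow>
     open \<Omega> \<and> connected \<Omega> \<and> \<Omega> \<noteq> {} \<and> bounded \<Omega> \<and>
     (\<forall>x\<in>frontier \<Omega>. \<exists>r>0. \<exists>\<nu>. norm \<nu> = 1 \<and>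
        (\<exists>\<phi>. \<exists>C. C-lipschitz_on {y. y \<bullet> \<nu> = 0} \<phi> \<and>
           \<Omega> \<inter> ball x r = {y \<in> ball x r. y \<bullet> \<nu> > \<phi> (y - (y \<bullet> \<nu>) *\<^sub>R \<nu>)}))"

definition M_plus :: "real \<Rightarrow> (real ^ 'n) set \<Rightarrow> (int ^ 'n) set" where
  "M_plus h \<Omega> = {m. node h m \<in> \<Omega>}"

definition M_minus :: "real \<Rightarrow> (real ^ 'n) set \<Rightarrow> (int ^ 'n) set" where
  "M_minus h \<Omega> = {m. node h m \<notin> closure \<Omega>}"

definition stencil_nodes :: "(int ^ 'n) set \<Rightarrow> (int ^ 'n) set" where
  "stencil_nodes M = M \<union> {m + e |m e. m \<in> M \<and> e \<in> unit_steps}"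

abbreviation N_plus :: "real \<Rightarrow> (real ^ 'n) set \<Rightarrow> (int ^ 'n) set" where
  "N_plus h \<Omega> \<equiv> stencil_nodes (M_plus h \<Omega>)"

abbreviation N_minus :: "real \<Rightarrow> (real ^ 'n) set \<Rightarrow> (int ^ 'n) set" where
  "N_minus h \<Omega> \<equiv> stencil_nodes (M_minus h \<Omega>)"

definition strip :: "real \<Rightarrow> (real ^ 'n) set \<Rightarrow> (int ^ 'n) set" where
  "strip h \<Omega> = N_plus h \<Omega> \<inter> N_minus h \<Omega>"

definition strip_minus :: "real \<Rightarrow> (real ^ 'n) set \<Rightarrow> (int ^ 'n) set" where
  "strip_minus h \<Omega> = strip h \<Omega> \<inter> M_minus h \<Omega>"

definition lattice_symbol :: "real ^ 'n \<Rightarrow> real" where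
  "lattice_symbol \<theta> = (\<Sum>j\<in>UNIV. 2 * (1 - cos (\<theta> $ j)))"

definition green_absorbing :: "real \<Rightarrow> real \<Rightarrow> int ^ 'n \<Rightarrow> real \<Rightarrow> complex" where
  "green_absorbing h k m \<epsilon> =
     1 / (2 * complex_of_real pi) ^ CARD('n) *
     integral (cbox (\<chi> j. - pi) (\<chi> j. pi) :: (real ^ 'n) set)
       (\<lambda>\<theta>. exp (\<i> * complex_of_real (\<Sum>j\<in>UNIV. real_of_int (m $ j) * \<theta> $ j)) /
             (complex_of_real (lattice_symbol \<theta> - k\<^sup>2 * h\<^sup>2) + \<i> * complex_of_real \<epsilon>))"

text \<open>\<open>green\<close> is only meaningful under \<open>green_exists\<close>; otherwise the limit operator
  \<open>Lim\<close> returns an unspecified value.\<close>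

definition green :: "real \<Rightarrow> real \<Rightarrow> int ^ 'n \<Rightarrow> complex" where
  "green h k m = Lim (at_right 0) (green_absorbing h k m)"

definition green_exists :: "'n::finite itself \<Rightarrow> real \<Rightarrow> real \<Rightarrow> bool" where
  "green_exists _ h k \<longleftrightarrow>
     (\<forall>m :: int ^ 'n. \<exists>l. (green_absorbing h k m \<longlongrightarrow> l) (at_right 0))"

definition supp :: "('a \<Rightarrow> complex) \<Rightarrow> 'a set" where
  "supp f = {m. f m \<noteq> 0}"

text \<open>\<open>outgoing h k f\<close> is \<open>G\<^sup>h \<ast> f\<close>; only to be used for \<open>f\<close> of finite support
  (the sum over an infinite index set is \<open>0\<close>).\<close>

definition outgoing :: "real \<Rightarrow> real \<Rightarrow> (int ^ 'n \<Rightarrow> complex) \<Rightarrow> int ^ 'n \<Rightarrow> complex" where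
  "outgoing h k f m = (complex_of_real h)\<^sup>2 * (\<Sum>n\<in>supp f. green h k (m - n) * f n)"

definition admissible_extension ::
  "real \<Rightarrow> real \<Rightarrow> (real ^ 'n) set \<Rightarrow> (int ^ 'n \<Rightarrow> complex) \<Rightarrow> (int ^ 'n \<Rightarrow> complex) \<Rightarrow> bool" where
  "admissible_extension h k \<Omega> \<xi> V \<longleftrightarrow>
     (\<forall>m\<in>strip h \<Omega>. V m = \<xi> m) \<and>
     finite (supp (helmholtz h k V)) \<and>
     (finite (supp V) \<or> V = outgoing h k (helmholtz h k V))"

definition shielding_control ::
  "real \<Rightarrow> real \<Rightarrow> (real ^ 'n) set \<Rightarrow> (int ^ 'n \<Rightarrow> complex) \<Rightarrow> (int ^ 'n \<Rightarrow> complex) \<Rightarrow>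
   (int ^ 'n \<Rightarrow> complex) \<Rightarrow> bool" where
  "shielding_control h k \<Omega> fp fm g \<longleftrightarrow>
     finite (supp g) \<and> supp g \<subseteq> M_minus h \<Omega> \<and>
     (\<forall>m\<in>N_plus h \<Omega>. outgoing h k (\<lambda>n. fp n + fm n + g n) m = outgoing h k fp m)"

definition nonresonant :: "real \<Rightarrow> real \<Rightarrow> (real ^ 'n) set \<Rightarrow> bool" where
  "nonresonant h k \<Omega> \<longleftrightarrow>
     (\<forall>u :: int ^ 'n \<Rightarrow> complex.
        (\<forall>m\<in>M_plus h \<Omega>. helmholtz h k u m = 0) \<and> (\<forall>m\<in>strip h \<Omega>. u m = 0)
        \<longrightarrow> (\<forall>m\<in>N_plus h \<Omega>. u m = 0))"

text \<open>The capacity matrix with respect to an enumeration \<open>\<gamma>\<^sub>1, \<gamma>\<^sub>2, \<dots>\<close> of the strip, given as a list.\<close>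

definition capacity_mat :: "real \<Rightarrow> real \<Rightarrow> (int ^ 'n) list \<Rightarrow> complex mat" where
  "capacity_mat h k \<gamma>s = mat (length \<gamma>s) (length \<gamma>s)
     (\<lambda>(i, j). (complex_of_real h)\<^sup>2 * green h k (\<gamma>s ! i - \<gamma>s ! j))"

end

theory Submission
  imports Defs
begin

text \<open>
  Since \<open>S\<^bsub>\<gamma>\<gamma>\<^esub>\<close> is invertible, there is a density \<open>\<rho>\<close> on the strip with \<open>V = G \<ast> \<rho> = \<xi>\<close> there, and
  \<open>L V = \<rho>\<close> lives on the strip, so the control \<open>g = -\<rho> 1\<^sub>M\<^sub>-\<close> lives on \<open>\<gamma>\<^sup>-\<close>.
  The function \<open>w = u\<^sup>+ + u\<^sup>- - V\<close> vanishes on the strip, so its restriction \<open>z = w 1\<^sub>N\<^sub>+\<close> satisfies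
  \<open>L z = (L w) 1\<^sub>M\<^sub>+ = f\<^sup>+ - \<rho> 1\<^sub>M\<^sub>+\<close>. As \<open>z\<close> is finitely supported, it is the
  outgoing solution \<open>G \<ast> (L z)\<close>; on \<open>N\<^sup>+\<close>, comparing it with \<open>w\<close> gives \<open>G \<ast> (f\<^sup>- + g) = 0\<close>.
\<close>

section \<open>Unit steps of the stencil\<close>

lemma unit_steps_eq:
  "(unit_steps :: (int ^ 'n::finite) set) = range (\<lambda>j. axis j 1) \<union> range (\<lambda>j. axis j (-1))"
proof (intro equalityI subsetI)
  fix e :: "int ^ 'n"
  assume "e \<in> unit_steps"
  then have e: "(\<Sum>j\<in>UNIV. \<bar>e $ j\<bar>) = 1"
    by (simp add: unit_steps_def)
  have "\<exists>j. e $ j \<noteq> 0"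
  proof (rule ccontr)
    assume "\<nexists>j. e $ j \<noteq> 0"
    then have "(\<Sum>j\<in>UNIV. \<bar>e $ j\<bar>) = 0"
      by simp
    with e show False by simp
  qed
  then obtain j where j: "e $ j \<noteq> 0" by blast
  have split: "\<bar>e $ j\<bar> + (\<Sum>i\<in>UNIV - {j}. \<bar>e $ i\<bar>) = 1"
    using e by (simp add: sum.remove [of UNIV j])
  have nonneg: "0 \<le> (\<Sum>i\<in>UNIV - {j}. \<bar>e $ i\<bar>)"
    by (simp add: sum_nonneg)
  have abs_j: "\<bar>e $ j\<bar> = 1" and rest: "(\<Sum>i\<in>UNIV - {j}. \<bar>e $ i\<bar>) = 0"
    using split nonneg j by linarith+
  have "e $ i = 0" if "i \<noteq> j" for i
    using rest that by (simp add: sum_nonneg_eq_0_iff)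
  then have "e = axis j (e $ j)"
    by (simp add: Finite_Cartesian_Product.vec_eq_iff axis_def)
  moreover have "e $ j = 1 \<or> e $ j = -1"
    using abs_j by linarith
  ultimately show "e \<in> range (\<lambda>j. axis j 1) \<union> range (\<lambda>j. axis j (-1))"
    by (metis UnCI rangeI)
next
  fix e :: "int ^ 'n"
  assume "e \<in> range (\<lambda>j. axis j 1) \<union> range (\<lambda>j. axis j (-1))"
  then show "e \<in> unit_steps"
    by (auto simp: unit_steps_def axis_def if_distrib [of abs] cong: if_cong)
qed

lemma finite_unit_steps [simp]: "finite (unit_steps :: (int ^ 'n::finite) set)"
  by (simp add: unit_steps_eq)

lemma uminus_unit_steps: "e \<in> unit_steps \<Longrightarrow> - e \<in> unit_steps"
  by (simp add: unit_steps_def)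

text \<open>Pairing the two opposite steps along each axis lets conjugate exponentials combine into
  cosines later.\<close>

lemma sum_unit_steps:
  "(\<Sum>e\<in>(unit_steps :: (int ^ 'n::finite) set). f e)
     = (\<Sum>j\<in>UNIV. f (axis j 1) + f (axis j (-1)))"
proof -
  have inj: "inj (\<lambda>j::'n. axis j (s::int))" if "s \<noteq> 0" for s
    using that by (auto simp: inj_def axis_eq_axis)
  have disj: "range (\<lambda>j::'n. axis j (1::int)) \<inter> range (\<lambda>j. axis j (-1)) = {}"
    by (auto simp: axis_eq_axis)
  show ?thesis
    unfolding unit_steps_eq
    by (subst sum.union_disjoint) (simp_all add: disj inj sum.reindex sum.distrib)
qed

section \<open>Lattice characters and the symbol\<close>

text \<open>The numerator of the integrand in \<open>green_absorbing\<close>, named so that its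
  multiplicativity in \<open>m\<close> can be used.\<close>

definition lattice_character :: "int ^ 'n \<Rightarrow> real ^ 'n \<Rightarrow> complex" where
  "lattice_character m \<theta> =
     exp (\<i> * complex_of_real (\<Sum>j\<in>UNIV. real_of_int (m $ j) * \<theta> $ j))"

lemma lattice_character_add:
  "lattice_character (m + n) \<theta> = lattice_character m \<theta> * lattice_character n \<theta>"
  by (simp add: lattice_character_def exp_add [symmetric] sum.distrib algebra_simps)

lemma lattice_character_axis:
  "lattice_character (axis j s) \<theta> = cis (of_int s * \<theta> $ j)"
proof -
  have "(\<Sum>i\<in>UNIV. real_of_int (axis j s $ i) * \<theta> $ i)
      = (\<Sum>i\<in>UNIV. if i = j then of_int s * \<theta> $ j else 0)"
    by (rule sum.cong) (auto simp: axis_def)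
  then show ?thesis
    by (simp add: lattice_character_def cis_conv_exp)
qed

text \<open>Characters are eigenfunctions of the stencil: a shift by a step multiplies by a phase,
  and each axis contributes \<open>cis t + cis (- t) - 2\<close>, which is
  \<open>- 2 * (1 - cos t)\<close>.\<close>

lemma sum_unit_steps_lattice_character:
  "(\<Sum>e\<in>unit_steps. lattice_character (m + e) \<theta> - lattice_character m \<theta>)
     = - complex_of_real (lattice_symbol \<theta>) * lattice_character m \<theta>"
proof -
  have "cis t + cis (- t) - 2 = - complex_of_real (2 * (1 - cos t))" for t
    by (simp add: complex_eq_iff)
  then have "(\<Sum>j\<in>UNIV. cis (\<theta> $ j) + cis (- \<theta> $ j) - 2) = - complex_of_real (lattice_symbol \<theta>)"
    by (simp add: lattice_symbol_def sum_negf [symmetric])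
  moreover have "(\<Sum>e\<in>unit_steps. lattice_character (m + e) \<theta> - lattice_character m \<theta>)
      = lattice_character m \<theta> * (\<Sum>j\<in>UNIV. cis (\<theta> $ j) + cis (- \<theta> $ j) - 2)"
    by (simp add: sum_unit_steps lattice_character_add lattice_character_axis sum_distrib_left
        algebra_simps)
  ultimately show ?thesis by simp
qed

lemma continuous_on_lattice_character [continuous_intros]:
  "continuous_on A (lattice_character m)"
  unfolding lattice_character_def by (intro continuous_intros)

lemma continuous_on_lattice_symbol [continuous_intros]:
  "continuous_on A lattice_symbol"
  unfolding lattice_symbol_def by (intro continuous_intros)

section \<open>Orthogonality of the characters on the cube\<close>

text \<open>The cube's indicator factorises over the coordinates, so an integral over the cube
  becomes a whole-space integral of a product, ready for Fubini.\<close>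

lemma prod_indicator_cart:
  fixes f :: "'n::finite \<Rightarrow> real \<Rightarrow> complex"
  shows "(\<Prod>j\<in>UNIV. indicator {a..b} (x $ j) *\<^sub>R f j (x $ j))
     = indicator (cbox (\<chi> j. a) (\<chi> j. b)) x *\<^sub>R (\<Prod>j\<in>UNIV. f j (x $ j))"
proof (cases "x \<in> cbox (\<chi> j. a) (\<chi> j. b)")
  case True
  then have "indicator {a..b} (x $ j) = (1::real)" for j
    by (simp add: mem_box_cart)
  with True show ?thesis by simp
next
  case False
  then obtain j where "x $ j \<notin> {a..b}"
    by (auto simp: mem_box_cart)
  then have "indicator {a..b} (x $ j) = (0::real)"
    by simp
  then have "(\<Prod>j\<in>UNIV. indicator {a..b} (x $ j) *\<^sub>R f j (x $ j)) = 0"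
    by (intro prod_zero) auto
  with False show ?thesis by simp
qed

text \<open>Lebesgue measure on \<open>real ^ 'n\<close> is the image of a product measure indexed
  by \<open>Basis\<close>. Reindexing \<open>Basis\<close> by coordinates reduces the claim to
  Fubini for finite products.\<close>

lemma lborel_integral_prod_cart:
  fixes f :: "'n::finite \<Rightarrow> real \<Rightarrow> complex"
  assumes "\<And>j. integrable lborel (f j)"
  shows "(LINT x|(lborel :: (real ^ 'n) measure). (\<Prod>j\<in>UNIV. f j (x $ j))) = (\<Prod>j\<in>UNIV. LINT t|lborel. f j t)"
proof -
  interpret product_sigma_finite "\<lambda>_ :: real ^ 'n. lborel :: real measure" ..
  have meas [measurable]: "f j \<in> borel_measurable borel" for j
    using assms [of j] by simp
  have axes: "Basis = range (\<lambda>j::'n. axis j (1::real))"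
    by (auto simp: Basis_vec_def)
  have inj: "inj (\<lambda>j::'n. axis j (1::real))"
    by (auto simp: inj_def axis_eq_axis)
  \<comment> \<open>\<open>F\<close> carries the family \<open>f\<close> from coordinates to the
    basis vectors that index the product measure.\<close>
  define F where "F b = f (inv_into UNIV (\<lambda>j. axis j (1::real)) b)" for b
  have F: "F (axis j 1) = f j" for j
    by (simp add: F_def inv_f_f [OF inj])
  have comp: "(\<Sum>b\<in>Basis. y b *\<^sub>R b) $ j = y (axis j 1)" for y :: "real ^ 'n \<Rightarrow> real" and j :: 'n
  proof -
    have "(\<Sum>b\<in>Basis. y b *\<^sub>R b) $ j = (\<Sum>b\<in>Basis. y b *\<^sub>R b) \<bullet> axis j 1"
      by (simp add: inner_axis)
    also have "\<dots> = y (axis j 1)"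
      by (rule inner_sum_left_Basis) (simp add: axes)
    finally show ?thesis .
  qed
  have lborel: "(lborel :: (real ^ 'n) measure)
      = distr (\<Pi>\<^sub>M b\<in>Basis. lborel) borel (\<lambda>y. \<Sum>b\<in>Basis. y b *\<^sub>R b)"
    by (rule lborel_eq)
  have "(LINT x|(lborel :: (real ^ 'n) measure). (\<Prod>j\<in>UNIV. f j (x $ j)))
      = (LINT y|(\<Pi>\<^sub>M b\<in>Basis. lborel). (\<Prod>j\<in>UNIV. f j ((\<Sum>b\<in>Basis. y b *\<^sub>R b) $ j)))"
    unfolding lborel
    by (subst integral_distr) auto
  also have "\<dots> = (LINT y|(\<Pi>\<^sub>M b\<in>Basis. lborel). (\<Prod>b\<in>Basis. F b (y b)))"
    by (simp only: comp) (simp add: axes prod.reindex inj F)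
  also have "\<dots> = (\<Prod>b\<in>Basis. LINT t|lborel. F b t)"
    by (rule product_integral_prod) (auto simp: axes F assms)
  also have "\<dots> = (\<Prod>j\<in>UNIV. LINT t|lborel. f j t)"
    by (simp add: axes prod.reindex inj F)
  finally show ?thesis .
qed

lemma integral_cis_int_period:
  "integral {-pi..pi} (\<lambda>t. cis (of_int n * t)) = (if n = 0 then 2 * complex_of_real pi else 0)"
proof (cases "n = 0")
  case True
  then show ?thesis by (simp add: scaleR_conv_of_real)
next
  case False
  let ?e = "\<lambda>z. exp (\<i> * of_int n * z)"
  let ?F = "\<lambda>t. cis (of_int n * t) / (\<i> * of_int n)"
  have cis: "cis (of_int n * t) = ?e (complex_of_real t)" for t
    by (simp add: cis_conv_exp mult_ac)
  have "((\<lambda>z. ?e z / (\<i> * of_int n)) has_field_derivative ?e z) (at z)" for z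
    using False by (auto intro!: derivative_eq_intros)
  then have "(?F has_vector_derivative cis (of_int n * t)) (at t within A)" for t A
    unfolding cis by (rule has_vector_derivative_real_field)
  then have "((\<lambda>t. cis (of_int n * t)) has_integral ?F pi - ?F (- pi)) {-pi..pi}"
    by (intro fundamental_theorem_of_calculus) auto
  \<comment> \<open>Periodicity: the antiderivative agrees at both endpoints, so the integral
    vanishes.\<close>
  moreover have "cis (of_int n * pi) = cis (of_int n * (- pi))"
    by (simp add: complex_eq_iff sin_integer_2pi mult.commute)
  ultimately show ?thesis
    using False by (simp add: integral_unique)
qed

text \<open>The character is a product of one-dimensional exponentials. If \<open>m\<close> is
  nonzero, a coordinate with \<open>m $ j \<noteq> 0\<close> gives a vanishing factor.\<close>

lemma integral_lattice_character:
  fixes m :: "int ^ 'n::finite"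
  shows "integral (cbox (\<chi> j. - pi) (\<chi> j. pi)) (lattice_character m)
     = (if m = 0 then (2 * complex_of_real pi) ^ CARD('n) else 0)"
proof -
  let ?Q = "cbox (\<chi> j. - pi) (\<chi> j. pi) :: (real ^ 'n) set"
  let ?c = "\<lambda>j t. cis (of_int (m $ j) * t)"
  have char: "lattice_character m \<theta> = (\<Prod>j\<in>UNIV. ?c j (\<theta> $ j))" for \<theta>
    by (simp add: lattice_character_def exp_sum sum_distrib_left cis_conv_exp)
  have int: "set_integrable lborel {-pi..pi} (?c j)" for j
    by (intro borel_integrable_atLeastAtMost') (intro continuous_intros)
  have "integral ?Q (lattice_character m) = (LINT x:?Q|lborel. lattice_character m x)"
    by (intro set_borel_integral_eq_integral(2) [symmetric] borel_integrable_compact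
        [folded set_integrable_def] continuous_intros) auto
  also have "\<dots> = (LINT x|lborel. (\<Prod>j\<in>UNIV. indicator {-pi..pi} (x $ j) *\<^sub>R ?c j (x $ j)))"
    by (simp add: set_lebesgue_integral_def prod_indicator_cart [of _ _ _ ?c] char)
  also have "\<dots> = (\<Prod>j\<in>UNIV. LINT t:{-pi..pi}|lborel. ?c j t)"
    unfolding set_lebesgue_integral_def
    by (rule lborel_integral_prod_cart) (use int in \<open>simp add: set_integrable_def\<close>)
  also have "\<dots> = (\<Prod>j\<in>UNIV. if m $ j = 0 then 2 * complex_of_real pi else 0)"
    using int by (simp add: set_borel_integral_eq_integral integral_cis_int_period)
  also have "\<dots> = (if m = 0 then (2 * complex_of_real pi) ^ CARD('n) else 0)"
  proof (cases "m = 0")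
    case False
    then obtain j where "m $ j \<noteq> 0"
      by (auto simp: Finite_Cartesian_Product.vec_eq_iff)
    then have "(\<Prod>j\<in>UNIV. if m $ j = 0 then 2 * complex_of_real pi else 0) = 0"
      by (intro prod_zero) auto
    with False show ?thesis by simp
  qed simp
  finally show ?thesis .
qed

section \<open>The Green's function as a fundamental solution\<close>

text \<open>Under the integral, h^2 times the operator multiplies the character by the denominator
  minus \<open>\<i> * \<epsilon>\<close>. The denominator cancels and leaves the bare character,
  whose integral is the delta; the remainder is the absorption defect.\<close>

lemma helmholtz_green_absorbing:
  fixes m :: "int ^ 'n::finite"
  assumes "h \<noteq> 0" and "\<epsilon> \<noteq> 0"
  shows "helmholtz h k (\<lambda>m. green_absorbing h k m \<epsilon>) m =
     ((if m = 0 then 1 else 0) - \<i> * complex_of_real \<epsilon> * green_absorbing h k m \<epsilon>)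
       / (complex_of_real h)\<^sup>2"
proof -
  let ?Q = "cbox (\<chi> j. - pi) (\<chi> j. pi) :: (real ^ 'n) set"
  let ?A = "1 / (2 * complex_of_real pi) ^ CARD('n)"
  define D where "D \<theta> = complex_of_real (lattice_symbol \<theta> - k\<^sup>2 * h\<^sup>2) + \<i> * complex_of_real \<epsilon>"
    for \<theta> :: "real ^ 'n"
  \<comment> \<open>The imaginary part of \<open>D\<close> is \<open>\<epsilon>\<close>, so the
    integrand is continuous even where the symbol equals
    \<open>k\<^sup>2 * h\<^sup>2\<close>.\<close>
  have D0: "D \<theta> \<noteq> 0" for \<theta>
    using \<open>\<epsilon> \<noteq> 0\<close> by (simp add: D_def complex_eq_iff)
  let ?g = "\<lambda>m \<theta>. lattice_character m \<theta> / D \<theta>"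
  have green: "green_absorbing h k m \<epsilon> = ?A * integral ?Q (?g m)" for m
    by (simp add: green_absorbing_def lattice_character_def D_def)
  have contD: "continuous_on ?Q D"
    unfolding D_def by (intro continuous_intros)
  have int: "?g m integrable_on ?Q" for m
    by (intro integrable_continuous continuous_intros contD) (simp add: D0)
  have int_char: "lattice_character m integrable_on ?Q" for m
    by (intro integrable_continuous continuous_intros)
  have pointwise: "- (\<Sum>e\<in>unit_steps. ?g (m + e) \<theta> - ?g m \<theta>)
        - (complex_of_real h)\<^sup>2 * (complex_of_real k)\<^sup>2 * ?g m \<theta>
      = lattice_character m \<theta> - \<i> * complex_of_real \<epsilon> * ?g m \<theta>" for \<theta>
  proof -
    define q where "q = ?g m \<theta>"
    have "(\<Sum>e\<in>unit_steps. ?g (m + e) \<theta> - ?g m \<theta>)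
        = - complex_of_real (lattice_symbol \<theta>) * q"
      using sum_unit_steps_lattice_character [of m \<theta>]
      by (simp add: q_def diff_divide_distrib [symmetric] sum_divide_distrib [symmetric])
    moreover have "lattice_character m \<theta> = D \<theta> * q"
      by (simp add: q_def D0)
    ultimately show ?thesis
      unfolding q_def [symmetric] by (simp add: D_def algebra_simps)
  qed
  have "(complex_of_real h)\<^sup>2 * helmholtz h k (\<lambda>m. green_absorbing h k m \<epsilon>) m
      = - (\<Sum>e\<in>unit_steps. green_absorbing h k (m + e) \<epsilon> - green_absorbing h k m \<epsilon>)
        - (complex_of_real h)\<^sup>2 * (complex_of_real k)\<^sup>2 * green_absorbing h k m \<epsilon>"
    using \<open>h \<noteq> 0\<close> by (simp add: helmholtz_def right_diff_distrib)
  also have "\<dots> = ?A * (- (\<Sum>e\<in>unit_steps. integral ?Q (?g (m + e)) - integral ?Q (?g m))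
        - (complex_of_real h)\<^sup>2 * (complex_of_real k)\<^sup>2 * integral ?Q (?g m))"
    by (simp only: green right_diff_distrib [symmetric] sum_distrib_left [symmetric])
       (simp add: algebra_simps)
  also have "\<dots> = ?A * integral ?Q (\<lambda>\<theta>. - (\<Sum>e\<in>unit_steps. ?g (m + e) \<theta> - ?g m \<theta>)
        - (complex_of_real h)\<^sup>2 * (complex_of_real k)\<^sup>2 * ?g m \<theta>)"
    by (subst integral_diff integral_sum integral_neg integral_mult_right;
        (intro integrable_diff integrable_sum integrable_neg integrable_on_mult_right int
            finite_unit_steps)?)+
       simp
  also have "\<dots> = ?A * (integral ?Q (lattice_character m)
        - \<i> * complex_of_real \<epsilon> * integral ?Q (?g m))"
    unfolding pointwise
    by (subst integral_diff; (intro int_char integrable_on_mult_right int)?)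
       (simp only: integral_mult_right)
  also have "\<dots> = (if m = 0 then 1 else 0) - \<i> * complex_of_real \<epsilon> * green_absorbing h k m \<epsilon>"
    by (simp add: green integral_lattice_character algebra_simps)
  finally show ?thesis
    using \<open>h \<noteq> 0\<close> by (simp add: field_simps)
qed

lemma green_tendsto:
  fixes m :: "int ^ 'n::finite"
  assumes "green_exists TYPE('n) h k"
  shows "(green_absorbing h k m \<longlongrightarrow> green h k m) (at_right 0)"
proof -
  obtain l where "(green_absorbing h k m \<longlongrightarrow> l) (at_right 0)"
    using assms by (auto simp: green_exists_def)
  then show ?thesis
    by (simp add: green_def tendsto_Lim)
qed

text \<open>The absorption defect \<open>\<i>\<epsilon> G\<^sup>\<epsilon>\<close> vanishes in the limit because \<open>G\<^sup>\<epsilon>\<close> converges; no further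
  information on the limit is needed.\<close>

lemma helmholtz_green:
  fixes m :: "int ^ 'n::finite"
  assumes "h \<noteq> 0" and "green_exists TYPE('n) h k"
  shows "helmholtz h k (green h k) m = (if m = 0 then 1 else 0) / (complex_of_real h)\<^sup>2"
proof (rule tendsto_unique)
  let ?L = "\<lambda>\<epsilon>. helmholtz h k (\<lambda>m. green_absorbing h k m \<epsilon>) m"
  note lim [tendsto_intros] = green_tendsto [OF assms(2)]
  show "(?L \<longlongrightarrow> helmholtz h k (green h k) m) (at_right 0)"
    unfolding helmholtz_def by (intro tendsto_intros)
  have "((\<lambda>\<epsilon>. ((if m = 0 then 1 else 0) - \<i> * complex_of_real \<epsilon> * green_absorbing h k m \<epsilon>)
       / (complex_of_real h)\<^sup>2) \<longlongrightarrow>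
       ((if m = 0 then 1 else 0) - \<i> * complex_of_real 0 * green h k m)
       / (complex_of_real h)\<^sup>2) (at_right 0)"
    using \<open>h \<noteq> 0\<close> by (intro tendsto_intros) auto
  \<comment> \<open>The identity for \<open>green_absorbing\<close> requires
    \<open>\<epsilon> \<noteq> 0\<close>, so it is used on a right neighbourhood of 0; the bound 1
    is arbitrary.\<close>
  moreover have "eventually (\<lambda>\<epsilon>. ((if m = 0 then 1 else 0)
       - \<i> * complex_of_real \<epsilon> * green_absorbing h k m \<epsilon>) / (complex_of_real h)\<^sup>2 = ?L \<epsilon>)
       (at_right 0)"
    unfolding eventually_at_right_field
    using \<open>h \<noteq> 0\<close> by (auto simp: helmholtz_green_absorbing intro!: exI [of _ 1])
  ultimately show "(?L \<longlongrightarrow> (if m = 0 then 1 else 0) / (complex_of_real h)\<^sup>2) (at_right 0)"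
    using Lim_transform_eventually by force
qed simp

section \<open>The operator and the convolution as mutual inverses\<close>

lemma helmholtz_cong:
  assumes "v m = w m" and "\<And>e. e \<in> unit_steps \<Longrightarrow> v (m + e) = w (m + e)"
  shows "helmholtz h k v m = helmholtz h k w m"
  by (simp add: helmholtz_def assms cong: sum.cong)

lemma helmholtz_sum:
  "helmholtz h k (\<lambda>m. \<Sum>i\<in>I. c i * v i m) m = (\<Sum>i\<in>I. c i * helmholtz h k (v i) m)"
proof -
  have "(\<Sum>e\<in>unit_steps. (\<Sum>i\<in>I. c i * v i (m + e)) - (\<Sum>i\<in>I. c i * v i m))
      = (\<Sum>i\<in>I. \<Sum>e\<in>unit_steps. c i * (v i (m + e) - v i m))"
    by (subst sum.swap) (simp add: sum_subtractf right_diff_distrib)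
  then show ?thesis
    by (simp add: helmholtz_def sum_distrib_left sum_subtractf right_diff_distrib sum_negf
        mult.left_commute)
qed

lemma helmholtz_shift: "helmholtz h k (\<lambda>m. v (m - n)) m = helmholtz h k v (m - n)"
  by (simp add: helmholtz_def algebra_simps)

text \<open>The summation set in \<open>outgoing\<close> depends on the source. A common finite
  superset allows convolutions of different sources to be combined termwise.\<close>

lemma outgoing_eq_sum:
  assumes "finite A" and "supp f \<subseteq> A"
  shows "outgoing h k f m = (\<Sum>n\<in>A. (complex_of_real h)\<^sup>2 * f n * green h k (m - n))"
proof -
  have "(\<Sum>n\<in>supp f. green h k (m - n) * f n) = (\<Sum>n\<in>A. green h k (m - n) * f n)"
    using assms by (intro sum.mono_neutral_left) (auto simp: supp_def)
  then show ?thesis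
    by (simp add: outgoing_def sum_distrib_left mult_ac)
qed

lemma outgoing_add:
  assumes "finite (supp f)" and "finite (supp g)"
  shows "outgoing h k (\<lambda>n. f n + g n) m = outgoing h k f m + outgoing h k g m"
proof -
  let ?A = "supp f \<union> supp g"
  have "supp (\<lambda>n. f n + g n) \<subseteq> ?A"
    by (auto simp: supp_def)
  then show ?thesis
    using assms by (simp add: outgoing_eq_sum [where A = ?A] sum.distrib [symmetric] algebra_simps)
qed

lemma outgoing_diff:
  assumes "finite (supp f)" and "finite (supp g)"
  shows "outgoing h k (\<lambda>n. f n - g n) m = outgoing h k f m - outgoing h k g m"
proof -
  let ?A = "supp f \<union> supp g"
  have "supp (\<lambda>n. f n - g n) \<subseteq> ?A"
    by (auto simp: supp_def)
  then show ?thesis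
    using assms
    by (simp add: outgoing_eq_sum [where A = ?A] sum_subtractf [symmetric] algebra_simps)
qed

text \<open>The weight h^2 cancels the normalisation of the delta, so only \<open>n = m\<close>
  survives; off the support both sides are zero. Both inversion identities below rest on
  this.\<close>

lemma sum_green_delta:
  fixes m :: "int ^ 'n::finite"
  assumes "h \<noteq> 0" and "green_exists TYPE('n) h k" and "finite (supp f)"
  shows "(\<Sum>n\<in>supp f. (complex_of_real h)\<^sup>2 * f n * helmholtz h k (green h k) (m - n)) = f m"
proof -
  have "(\<Sum>n\<in>supp f. (complex_of_real h)\<^sup>2 * f n * helmholtz h k (green h k) (m - n))
      = (\<Sum>n\<in>supp f. if m = n then f n else 0)"
    using assms by (intro sum.cong) (auto simp: helmholtz_green)
  also have "\<dots> = f m"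
    using assms(3) by (auto simp: supp_def)
  finally show ?thesis .
qed

text \<open>The convolution is a finite combination of shifted copies of \<open>green h k\<close>,
  so the operator acts on each copy separately.\<close>

lemma helmholtz_outgoing:
  fixes f :: "int ^ 'n::finite \<Rightarrow> complex"
  assumes "h \<noteq> 0" and "green_exists TYPE('n) h k" and "finite (supp f)"
  shows "helmholtz h k (outgoing h k f) = f"
proof
  fix m
  show "helmholtz h k (outgoing h k f) m = f m"
    using assms
    by (simp add: outgoing_eq_sum [OF assms(3) subset_refl, abs_def] helmholtz_sum
        helmholtz_shift sum_green_delta)
qed

lemma finite_stencil_nodes:
  assumes "finite (A :: (int ^ 'n::finite) set)"
  shows "finite (stencil_nodes A)"
proof -
  have "{m + e |m e. m \<in> A \<and> e \<in> unit_steps} = (\<lambda>(m, e). m + e) ` (A \<times> unit_steps)"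
    by auto
  with assms show ?thesis
    by (simp add: stencil_nodes_def)
qed

text \<open>The stencil is symmetric: a node that has a neighbour in the support is itself a
  neighbour of that support node.\<close>

lemma supp_helmholtz: "supp (helmholtz h k v) \<subseteq> stencil_nodes (supp v)"
proof
  fix m
  assume "m \<in> supp (helmholtz h k v)"
  then have "v m \<noteq> 0 \<or> (\<exists>e\<in>unit_steps. v (m + e) \<noteq> 0)"
    by (rule contrapos_pp) (simp add: supp_def helmholtz_def)
  then show "m \<in> stencil_nodes (supp v)"
  proof
    assume "\<exists>e\<in>unit_steps. v (m + e) \<noteq> 0"
    then obtain e where "- e \<in> unit_steps" "m + e \<in> supp v"
      using uminus_unit_steps by (auto simp: supp_def)
    moreover have "m = (m + e) + - e"
      by simp
    ultimately show ?thesis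
      unfolding stencil_nodes_def by blast
  qed (simp add: supp_def stencil_nodes_def)
qed

text \<open>Summation by parts moves the operator from \<open>v\<close> onto the Green's function.
  Finite support leaves no boundary terms, so no uniqueness theorem for outgoing solutions has to be
  invoked.\<close>

lemma outgoing_helmholtz:
  fixes v :: "int ^ 'n::finite \<Rightarrow> complex"
  assumes "h \<noteq> 0" and "green_exists TYPE('n) h k" and fin: "finite (supp v)"
  shows "outgoing h k (helmholtz h k v) = v"
proof
  fix m
  let ?A = "stencil_nodes (supp v)"
  let ?G = "green h k"
  have finA: "finite ?A"
    using fin by (rule finite_stencil_nodes)
  have restrict: "(\<Sum>n\<in>?A. ?G (m - n) * v n) = (\<Sum>n\<in>supp v. ?G (m - n) * v n)"
    using finA by (intro sum.mono_neutral_right) (auto simp: stencil_nodes_def supp_def)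
  \<comment> \<open>Substituting \<open>n + e\<close> for \<open>n\<close> discards only terms with
    \<open>v (n + e) = 0\<close>. The set \<open>?A\<close> is large enough, as it contains
    \<open>n - e\<close> for every support node \<open>n\<close>.\<close>
  have shift: "(\<Sum>n\<in>?A. ?G (m - n) * v (n + e)) = (\<Sum>n\<in>supp v. ?G (m - n + e) * v n)"
    if e: "e \<in> unit_steps" for e
  proof (rule sum.reindex_bij_witness_not_neutral
      [where i = "\<lambda>n. n - e" and j = "\<lambda>n. n + e" and S' = "{n \<in> ?A. v (n + e) = 0}" and T' = "{}"])
    show "n - e \<in> ?A - {n \<in> ?A. v (n + e) = 0}" if "n \<in> supp v - {}" for n
    proof -
      have "n + - e \<in> ?A"
        using that uminus_unit_steps [OF e] unfolding stencil_nodes_def by blast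
      with that show ?thesis by (simp add: supp_def)
    qed
  qed (use finA in \<open>auto simp: supp_def algebra_simps\<close>)
  have "outgoing h k (helmholtz h k v) m
      = (complex_of_real h)\<^sup>2 * (\<Sum>n\<in>?A. ?G (m - n) * helmholtz h k v n)"
    by (simp add: outgoing_eq_sum [OF finA supp_helmholtz] sum_distrib_left mult_ac)
  also have "(\<Sum>n\<in>?A. ?G (m - n) * helmholtz h k v n)
      = - (1 / (complex_of_real h)\<^sup>2)
          * (\<Sum>e\<in>unit_steps. (\<Sum>n\<in>?A. ?G (m - n) * v (n + e)) - (\<Sum>n\<in>?A. ?G (m - n) * v n))
        - (complex_of_real k)\<^sup>2 * (\<Sum>n\<in>?A. ?G (m - n) * v n)"
    unfolding sum_subtractf [symmetric]
    by (subst sum.swap)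
       (simp add: helmholtz_def sum_distrib_left sum_subtractf [symmetric] sum_negf [symmetric]
        right_diff_distrib diff_divide_distrib mult_ac)
  also have "\<dots> = - (1 / (complex_of_real h)\<^sup>2)
          * (\<Sum>e\<in>unit_steps. (\<Sum>n\<in>supp v. ?G (m - n + e) * v n) - (\<Sum>n\<in>supp v. ?G (m - n) * v n))
        - (complex_of_real k)\<^sup>2 * (\<Sum>n\<in>supp v. ?G (m - n) * v n)"
    by (simp add: restrict shift cong: sum.cong)
  also have "\<dots> = (\<Sum>n\<in>supp v. helmholtz h k ?G (m - n) * v n)"
    unfolding sum_subtractf [symmetric]
    by (subst sum.swap)
       (simp add: helmholtz_def sum_distrib_left sum_distrib_right sum_subtractf [symmetric]
        sum_negf [symmetric] left_diff_distrib right_diff_distrib diff_divide_distrib mult_ac)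
  also have "(complex_of_real h)\<^sup>2 * \<dots> = v m"
    using sum_green_delta [OF assms, of m] by (simp add: sum_distrib_left mult_ac)
  finally show "outgoing h k (helmholtz h k v) m = v m" .
qed

section \<open>Finiteness of the interior node set\<close>

lemma finite_M_plus:
  fixes \<Omega> :: "(real ^ 'n::finite) set"
  assumes "h > 0" and "bounded \<Omega>"
  shows "finite (M_plus h \<Omega>)"
proof -
  obtain B where B: "\<And>x. x \<in> \<Omega> \<Longrightarrow> norm x \<le> B"
    using \<open>bounded \<Omega>\<close> by (auto simp: bounded_iff)
  \<comment> \<open>A coordinate of a node is bounded by the norm, hence by \<open>B\<close>, so the
    index is at most \<open>B / h\<close> in absolute value.\<close>
  define N where "N = \<lceil>B / h\<rceil>"
  have "m $ j \<in> {-N..N}" if "m \<in> M_plus h \<Omega>" for m j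
  proof -
    have "h * \<bar>real_of_int (m $ j)\<bar> = \<bar>node h m $ j\<bar>"
      using \<open>h > 0\<close> by (simp add: node_def abs_mult)
    also have "\<dots> \<le> B"
      using that B component_le_norm_cart order_trans by (fastforce simp: M_plus_def)
    finally have "real_of_int \<bar>m $ j\<bar> \<le> B / h"
      using \<open>h > 0\<close> by (simp add: field_simps)
    then show ?thesis
      unfolding N_def atLeastAtMost_iff by linarith
  qed
  then have "vec_nth m \<in> (\<Pi>\<^sub>E j\<in>UNIV. {-N..N})" if "m \<in> M_plus h \<Omega>" for m
    using that by (simp add: PiE_UNIV_domain)
  then have "M_plus h \<Omega> \<subseteq> vec_lambda ` (\<Pi>\<^sub>E j\<in>UNIV. {-N..N})"
    by (metis image_eqI subsetI vec_nth_inverse)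
  then show ?thesis
    by (rule finite_subset) (simp add: finite_PiE)
qed

section \<open>Prescribing values on the strip\<close>

lemma invertible_mat_solve:
  fixes A :: "complex mat"
  assumes "invertible_mat A" and "A \<in> carrier_mat n n" and "b \<in> carrier_vec n"
  obtains x where "x \<in> carrier_vec n" and "A *\<^sub>v x = b"
proof -
  obtain B where AB: "A * B = 1\<^sub>m n" and BA: "B * A = 1\<^sub>m (dim_row B)"
    using assms by (auto simp: invertible_mat_def inverts_mat_def)
  \<comment> \<open>The definition of invertibility does not state the dimensions of
    \<open>B\<close>; they are read off from the two products.\<close>
  have "dim_col B = n"
    using arg_cong [OF AB, of dim_col] by simp
  moreover have "dim_row B = n"
    using arg_cong [OF BA, of dim_col] assms(2) by simp
  ultimately have B: "B \<in> carrier_mat n n"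
    by blast
  have "A *\<^sub>v (B *\<^sub>v b) = A * B *\<^sub>v b"
    using assms(2,3) B by (simp add: assoc_mult_mat_vec)
  also have "\<dots> = b"
    using assms(3) by (simp add: AB)
  finally show thesis
    using that B assms(3) by (meson mult_mat_vec_carrier)
qed

text \<open>Multiplying the capacity matrix by the values of a density gives its potential
  \<open>outgoing h k \<rho>\<close> at the listed nodes, so prescribing the potential there is a
  linear system.\<close>

lemma capacity_mat_solve:
  fixes \<xi> :: "int ^ 'n::finite \<Rightarrow> complex"
  assumes "distinct \<gamma>s" and "invertible_mat (capacity_mat h k \<gamma>s)"
  obtains \<rho> where "supp \<rho> \<subseteq> set \<gamma>s" and "\<And>m. m \<in> set \<gamma>s \<Longrightarrow> outgoing h k \<rho> m = \<xi> m"
proof -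
  let ?n = "length \<gamma>s" and ?S = "capacity_mat h k \<gamma>s"
  have S: "?S \<in> carrier_mat ?n ?n"
    by (simp add: capacity_mat_def)
  obtain x where x: "x \<in> carrier_vec ?n" and Sx: "?S *\<^sub>v x = Matrix.vec ?n (\<lambda>i. \<xi> (\<gamma>s ! i))"
    using invertible_mat_solve [OF assms(2) S] by (metis vec_carrier)
  \<comment> \<open>Extends the solution vector by zero off the list; since the list is distinct, at
    most one summand is nonzero.\<close>
  define \<rho> where "\<rho> m = (\<Sum>i<?n. if \<gamma>s ! i = m then Matrix.vec_index x i else 0)" for m
  have \<rho>: "\<rho> (\<gamma>s ! i) = Matrix.vec_index x i" if "i < ?n" for i
  proof -
    have "\<rho> (\<gamma>s ! i) = (\<Sum>j<?n. if j = i then Matrix.vec_index x j else 0)"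
      unfolding \<rho>_def using that assms(1) by (intro sum.cong) (auto simp: nth_eq_iff_index_eq)
    with that show ?thesis by simp
  qed
  have supp: "supp \<rho> \<subseteq> set \<gamma>s"
    by (force simp: supp_def \<rho>_def intro!: sum.neutral dest: sum.not_neutral_contains_not_neutral
        split: if_splits)
  have "outgoing h k \<rho> (\<gamma>s ! i) = \<xi> (\<gamma>s ! i)" if i: "i < ?n" for i
  proof -
    have "outgoing h k \<rho> (\<gamma>s ! i)
        = (\<Sum>n\<in>set \<gamma>s. (complex_of_real h)\<^sup>2 * \<rho> n * green h k (\<gamma>s ! i - n))"
      using supp by (simp add: outgoing_eq_sum)
    also have "\<dots> = (\<Sum>j<?n. (complex_of_real h)\<^sup>2 * \<rho> (\<gamma>s ! j) * green h k (\<gamma>s ! i - \<gamma>s ! j))"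
      using assms(1) by (intro sum.reindex_bij_betw [symmetric] bij_betw_nth) auto
    also have "\<dots> = Matrix.vec_index (?S *\<^sub>v x) i"
      using i x
      by (auto simp: capacity_mat_def scalar_prod_def \<rho> atLeast0LessThan mult_ac intro!: sum.cong)
    also have "\<dots> = \<xi> (\<gamma>s ! i)"
      using i by (simp add: Sx)
    finally show ?thesis .
  qed
  with supp that show thesis
    by (metis in_set_conv_nth)
qed

section \<open>Construction of the control\<close>

theorem proposition4p6:
  fixes h k :: real
    and \<Omega> :: "(real ^ 'n::finite) set"
    and \<gamma>s :: "(int ^ 'n) list"
    and fp fm :: "int ^ 'n \<Rightarrow> complex"
  assumes "CARD('n) \<in> {2, 3}"
    and "h > 0" and "k > 0"
    and "green_exists TYPE('n) h k"
    and "bounded_lipschitz_domain \<Omega>"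
    and "\<And>m :: int ^ 'n. node h m \<notin> frontier \<Omega>"
    and "nonresonant h k \<Omega>"
    and "distinct \<gamma>s" and "set \<gamma>s = strip h \<Omega>"
    and "invertible_mat (capacity_mat h k \<gamma>s)"
    and "finite (supp fp)" and "supp fp \<subseteq> M_plus h \<Omega>"
    and "finite (supp fm)" and "supp fm \<subseteq> M_minus h \<Omega>"
  shows "\<exists>V. admissible_extension h k \<Omega> (\<lambda>m. outgoing h k fp m + outgoing h k fm m) V \<and>
           shielding_control h k \<Omega> fp fm
             (\<lambda>m. - helmholtz h k V m * indicator (M_minus h \<Omega>) m) \<and>
           supp (\<lambda>m. - helmholtz h k V m * indicator (M_minus h \<Omega>) m) \<subseteq> strip_minus h \<Omega>"

proof -
  let ?Mp = "M_plus h \<Omega>" and ?Mm = "M_minus h \<Omega>" and ?\<gamma> = "strip h \<Omega>"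
  let ?\<xi> = "\<lambda>m. outgoing h k fp m + outgoing h k fm m"
  let ?L = "helmholtz h k" and ?P = "outgoing h k :: (int ^ 'n \<Rightarrow> complex) \<Rightarrow> _"
  have h0: "h \<noteq> 0" using assms(2) by simp
  note L_outgoing = helmholtz_outgoing [OF h0 assms(4)]
  \<comment> \<open>With no node on the frontier, a node in the closure already lies in
    \<open>\<Omega>\<close>, so the two node sets are complementary.\<close>
  have cover: "m \<in> ?Mm \<longleftrightarrow> m \<notin> ?Mp" for m
    using assms(5) assms(6) [of m]
    by (auto simp: M_plus_def M_minus_def bounded_lipschitz_domain_def closure_Un_frontier)
  have "finite ?Mp"
    using assms(2,5) by (intro finite_M_plus) (auto simp: bounded_lipschitz_domain_def)
  then have finN: "finite (N_plus h \<Omega>)"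
    by (rule finite_stencil_nodes)
  obtain \<rho> where supp_\<rho>: "supp \<rho> \<subseteq> ?\<gamma>" and \<rho>: "\<And>m. m \<in> ?\<gamma> \<Longrightarrow> ?P \<rho> m = ?\<xi> m"
    using capacity_mat_solve [OF assms(8,10), of ?\<xi>] assms(9) by metis
  have fin_\<rho>: "finite (supp \<rho>)"
    using supp_\<rho> finN by (auto simp: strip_def intro: finite_subset)
  have L\<rho>: "?L (?P \<rho>) = \<rho>"
    using fin_\<rho> by (rule L_outgoing)
  define \<rho>p where "\<rho>p m = \<rho> m * indicator ?Mp m" for m
  \<comment> \<open>As the extension is \<open>?P \<rho>\<close> with
    \<open>?L (?P \<rho>) = \<rho>\<close>, this is the control of the statement; its sign gives
    \<open>\<rho> = \<rho>p - g\<close>.\<close>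
  define g where "g m = - \<rho> m * indicator ?Mm m" for m
  have \<rho>_split: "\<rho> m = \<rho>p m - g m" for m
    using cover [of m] by (auto simp: \<rho>p_def g_def indicator_def)
  have fin_\<rho>p: "finite (supp \<rho>p)" and fin_g: "finite (supp g)"
    using fin_\<rho> by (auto simp: supp_def \<rho>p_def g_def elim!: rev_finite_subset)
  let ?f = "\<lambda>m. fp m + fm m"
  have fin_f: "finite (supp ?f)"
    by (rule finite_subset [of _ "supp fp \<union> supp fm"])
       (use assms(11,13) in \<open>auto simp: supp_def\<close>)
  have fin_fr: "finite (supp (\<lambda>m. ?f m - \<rho> m))"
    by (rule finite_subset [of _ "supp ?f \<union> supp \<rho>"])
       (use fin_f fin_\<rho> in \<open>auto simp: supp_def\<close>)
  \<comment> \<open>Writing \<open>w\<close> as one convolution makes \<open>?L w\<close> immediate;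
    linearity then shows that \<open>w\<close> vanishes on the strip.\<close>
  define w where "w = ?P (\<lambda>m. ?f m - \<rho> m)"
  have w: "w m = ?\<xi> m - ?P \<rho> m" for m
    using assms(11,13) fin_f fin_\<rho> by (simp add: w_def outgoing_diff outgoing_add)
  define z where "z m = w m * indicator (N_plus h \<Omega>) m" for m
  \<comment> \<open>A node of \<open>N_minus\<close> is either outside \<open>N_plus\<close>, where
    \<open>z\<close> is cut off, or on the strip, where \<open>w\<close> vanishes.\<close>
  have z_minus: "z m = 0" if "m \<in> N_minus h \<Omega>" for m
    using that \<rho> by (auto simp: z_def w strip_def indicator_def)
  \<comment> \<open>Truncating \<open>w\<close> to \<open>N\<^sup>+\<close> keeps the stencils in \<open>M\<^sup>+\<close> and, since \<open>w = 0\<close> on the strip, kills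
    those in \<open>M\<^sup>-\<close>.\<close>
  have "?L z m = fp m - \<rho>p m" for m
  proof (cases "m \<in> ?Mp")
    case True
    then have "?L z m = ?L w m"
      by (intro helmholtz_cong) (auto simp: z_def stencil_nodes_def indicator_def)
    also have "\<dots> = ?f m - \<rho> m"
      by (simp add: w_def L_outgoing [OF fin_fr])
    also have "\<dots> = fp m - \<rho>p m"
      using True cover [of m] assms(14) by (auto simp: \<rho>p_def supp_def)
    finally show ?thesis .
  next
    case False
    then have "m \<in> ?Mm" by (simp add: cover)
    then have "?L z m = ?L (\<lambda>_. 0) m"
      by (intro helmholtz_cong z_minus) (auto simp: stencil_nodes_def)
    also have "\<dots> = fp m - \<rho>p m"
      using False assms(12) by (auto simp: helmholtz_def \<rho>p_def supp_def)
    finally show ?thesis .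
  qed
  then have Lz: "?L z = (\<lambda>m. fp m - \<rho>p m)" by blast
  have "finite (supp z)"
    by (rule finite_subset [OF _ finN]) (auto simp: supp_def z_def indicator_def)
  then have z: "z = ?P (\<lambda>m. fp m - \<rho>p m)"
    using outgoing_helmholtz [OF h0 assms(4), of z] by (simp add: Lz)
  \<comment> \<open>Here \<open>w = z\<close> reads
    \<open>?\<xi> - ?P \<rho> = ?P fp - ?P \<rho>p\<close>. Inserting
    \<open>\<rho> = \<rho>p - g\<close> leaves \<open>?P fm + ?P g = 0\<close>.\<close>
  have "?P (\<lambda>n. fp n + fm n + g n) m = ?P fp m" if "m \<in> N_plus h \<Omega>" for m
  proof -
    have "w m = z m"
      using that by (simp add: z_def)
    moreover have "?P \<rho> m = ?P \<rho>p m - ?P g m"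
      using fin_\<rho>p fin_g by (simp add: \<rho>_split [abs_def] outgoing_diff)
    ultimately show ?thesis
      using assms(11,13) fin_f fin_g fin_\<rho>p by (simp add: w z outgoing_add outgoing_diff)
  qed
  moreover have "supp g \<subseteq> ?\<gamma> \<inter> ?Mm"
    using supp_\<rho> by (auto simp: supp_def g_def indicator_def)
  moreover have "(\<lambda>m. - ?L (?P \<rho>) m * indicator ?Mm m) = g"
    by (auto simp: L\<rho> g_def)
  \<comment> \<open>The second alternative of admissibility applies:
    \<open>?L (?P \<rho>) = \<rho>\<close> makes the extension the outgoing solution of its own
    source.\<close>
  moreover have "admissible_extension h k \<Omega> ?\<xi> (?P \<rho>)"
    using \<rho> fin_\<rho> by (simp add: admissible_extension_def L\<rho>)
  ultimately show ?thesis
    using fin_g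
    by (intro exI [of _ "?P \<rho>"]) (auto simp: shielding_control_def strip_minus_def)
qed

end
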